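(* Let $\Gamma$ be a locally finite graph, $F$ a field with an absolute value $|\cdot|_{\rm v}$, and $\lambda\in F$. If $W$ is a vector subspace of $F^{V(\Gamma)}$, then $$\mathrm{Cl}\big((A_{\Gamma,F}-\lambda E)(W)\big)=(A_{\Gamma,F}-\lambda E)(\mathrm{Cl}(W)).$$ In other words, $A_{\Gamma,F}-\lambda E$ maps closed vector subspaces of $F^{V(\Gamma)}$ to closed vector subspaces.
   Context: A graph is an undirected graph without loops or multiple edges, with vertex set $V(\Gamma)$; $\Gamma(v)$ is the set of vertices adjacent to $v$. $\Gamma$ is locally finite if every $\Gamma(v)$ is finite (it may be infinite and disconnected). The absolute value $|\cdot|_{\rm v}$ may be trivial; $F$ carries the topology of the metric defined by it, and the $F$-vector space $F^{V(\Gamma)}$ of all functions $V(\Gamma)\to F$ carries the corresponding product topology. $\mathrm{Cl}$ denotes closure in $F^{V(\Gamma)}$. $A_{\Gamma,F}:F^{V(\Gamma)}\to F^{V(\Gamma)}$ is the (continuous) linear operator $(A_{\Gamma,F}(f))(v)=\sum_{u\in\Gamma(v)}f(u)$, and $E$ is the identity operator. *)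

theory Defs
  imports "HOL-Analysis.Analysis"
begin

text \<open>Graphs may be infinite, disconnected, or empty; edges are two-element sets of vertices.\<close>

locale simple_graph =
  fixes V :: "'v set" and E :: "'v set set"
  assumes edges: "e \<in> E \<Longrightarrow> e \<subseteq> V \<and> card e = 2"

definition neighbours :: "'v set \<Rightarrow> 'v set set \<Rightarrow> 'v \<Rightarrow> 'v set" where
  "neighbours V E v = {u \<in> V. {v, u} \<in> E}"

locale locally_finite_graph = simple_graph V E
  for V :: "'v set" and E :: "'v set set" +
  assumes finite_neighbours: "v \<in> V \<Longrightarrow> finite (neighbours V E v)"

text \<open>Archimedean, non-archimedean and trivial absolute values are all allowed, and the field
  need not be complete.\<close>

locale absolute_value =
  fixes av :: "'a::field \<Rightarrow> real"
  assumes nonneg: "0 \<le> av x"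
    and eq_zero_iff: "av x = 0 \<longleftrightarrow> x = 0"
    and mult: "av (x * y) = av x * av y"
    and triangle_ineq: "av (x + y) \<le> av x + av y"
begin

lemma av_one: "av 1 = 1"
  using mult[of 1 1] eq_zero_iff[of 1] by simp

lemma av_minus: "av (- x) = av x"
proof -
  have "av (- 1) * av (- 1) = 1"
    using mult[of "- 1" "- 1"] av_one by simp
  then have "av (- 1) = 1"
    using nonneg[of "- 1"] by (simp add: square_eq_1_iff)
  then show ?thesis
    using mult[of "- 1" x] by simp
qed

sublocale Metric_space UNIV "\<lambda>x y. av (x - y)"
proof
  show "0 \<le> av (x - y)" for x y
    by (rule nonneg)
  show "av (x - y) = av (y - x)" for x y
    using av_minus[of "x - y"] by simp
  show "av (x - y) = 0 \<longleftrightarrow> x = y" for x y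
    by (simp add: eq_zero_iff)
  show "av (x - z) \<le> av (x - y) + av (y - z)" for x y z
    using triangle_ineq[of "x - y" "y - z"] by simp
qed

end

definition field_topology :: "('a::field \<Rightarrow> real) \<Rightarrow> 'a topology" where
  "field_topology av = Metric_space.mtopology UNIV (\<lambda>x y. av (x - y))"

text \<open>The functions from \<open>V\<close> to the field are the elements of \<open>V \<rightarrow>\<^sub>E UNIV\<close> (fixed to
  \<open>undefined\<close> outside \<open>V\<close>), which is the carrier of the library's product topology.
  Hence the vector space operations below are restricted to \<open>V\<close>.\<close>

definition function_topology :: "'v set \<Rightarrow> ('a::field \<Rightarrow> real) \<Rightarrow> ('v \<Rightarrow> 'a) topology" where
  "function_topology V av = product_topology (\<lambda>_. field_topology av) V"

definition function_subspace :: "'v set \<Rightarrow> ('v \<Rightarrow> 'a::field) set \<Rightarrow> bool" where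
  "function_subspace V W \<longleftrightarrow>
     W \<subseteq> V \<rightarrow>\<^sub>E UNIV \<and>
     (\<lambda>v\<in>V. 0) \<in> W \<and>
     (\<forall>f\<in>W. \<forall>g\<in>W. (\<lambda>v\<in>V. f v + g v) \<in> W) \<and>
     (\<forall>c. \<forall>f\<in>W. (\<lambda>v\<in>V. c * f v) \<in> W)"

definition adjacency_operator ::
    "'v set \<Rightarrow> 'v set set \<Rightarrow> ('v \<Rightarrow> 'a::field) \<Rightarrow> 'v \<Rightarrow> 'a" where
  "adjacency_operator V E f = (\<lambda>v\<in>V. \<Sum>u\<in>neighbours V E v. f u)"

definition shifted_adjacency_operator ::
    "'v set \<Rightarrow> 'v set set \<Rightarrow> 'a \<Rightarrow> ('v \<Rightarrow> 'a::field) \<Rightarrow> 'v \<Rightarrow> 'a" where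
  "shifted_adjacency_operator V E c f = (\<lambda>v\<in>V. adjacency_operator V E f v - c * f v)"

lemma topspace_function_topology:
  assumes "absolute_value av"
  shows "topspace (function_topology V av) = V \<rightarrow>\<^sub>E UNIV"
proof -
  interpret absolute_value av by fact
  show ?thesis
    by (simp add: function_topology_def field_topology_def)
qed

end

theory Submission
  imports Defs "HOL-Library.Function_Algebras"
begin

text \<open>
  Finitely supported functions \<open>p\<close> on \<open>V\<close> are paired with arbitrary functions \<open>f\<close> by
  \<open>pairing p f = (\<Sum>v. p v * f v)\<close>. The proof rests on two facts about this pairing.

  \<^item> The closure of a subspace \<open>W\<close> consists of the functions killed by every finitely
    supported \<open>p\<close> that kills \<open>W\<close> (\<open>closure_of_subspace_iff\<close>). Each \<open>p\<close> is a
    continuous functional, so it kills the closure. Conversely, if all these \<open>p\<close> kill \<open>f\<close>, then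
    on each finite set \<open>f\<close> agrees exactly with some member of \<open>W\<close>, because a subspace of a
    finite-dimensional space is cut out by linear functionals. So the closure is the same for
    every absolute value, the trivial one included.

  \<^item> A linear system of finitely supported equations \<open>pairing p f = b\<close> is solvable as soon as
    no linear combination of its equations reads \<open>0 = b\<close> with \<open>b \<noteq> 0\<close>
    (\<open>solvable_if_consistent\<close>). For \<open>f\<close> is then the same thing as a linear functional
    on the finitely supported functions, and linear functionals extend from subspaces.

  Local finiteness says that the operator \<open>T\<close> = \<open>A - c E\<close> has finitely supported rows, hence
  a transpose that maps finitely supported functions to finitely supported functions, with
  \<open>pairing (transpose p) f = pairing p (T f)\<close>. So \<open>p\<close> kills \<open>T W\<close> iff \<open>transpose p\<close>
  kills \<open>W\<close>. The inclusion of \<open>T (Cl W)\<close> in \<open>Cl (T W)\<close> follows at once. For the other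
  inclusion let \<open>g\<close> be in \<open>Cl (T W)\<close>. A preimage of \<open>g\<close> in \<open>Cl W\<close> is a solution \<open>f\<close> of the
  system \<open>pairing n f = 0\<close> for all \<open>n\<close> killing \<open>W\<close>, together with
  \<open>pairing (transpose p) f = pairing p g\<close> for all \<open>p\<close>. It is consistent: if
  \<open>n + transpose p = 0\<close>, then \<open>transpose p\<close> kills \<open>W\<close>, so \<open>p\<close> kills \<open>T W\<close> and
  therefore \<open>g\<close>.
\<close>

section \<open>Finitely supported linear equations\<close>

definition supp :: "('v \<Rightarrow> 'a::zero) \<Rightarrow> 'v set" where
  "supp p = {v. p v \<noteq> 0}"

definition pairing :: "('v \<Rightarrow> 'a::field) \<Rightarrow> ('v \<Rightarrow> 'a) \<Rightarrow> 'a" where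
  "pairing p f = (\<Sum>v\<in>supp p. p v * f v)"

lemma pairing_superset:
  assumes "finite S" "supp p \<subseteq> S"
  shows "pairing p f = (\<Sum>v\<in>S. p v * f v)"
  unfolding pairing_def
  by (rule sum.mono_neutral_left) (use assms in \<open>auto simp: supp_def\<close>)

lemma pairing_cong:
  assumes "\<And>v. v \<in> supp p \<Longrightarrow> f v = g v"
  shows "pairing p f = pairing p g"
  unfolding pairing_def using assms by (auto intro: sum.cong)

lemma supp_add: "supp (p + q) \<subseteq> supp p \<union> supp (q :: 'v \<Rightarrow> 'a::field)"
  by (auto simp: supp_def)

lemma supp_scale: "supp (\<lambda>v. k * p v) \<subseteq> supp (p :: 'v \<Rightarrow> 'a::field)"
  by (auto simp: supp_def)

lemma pairing_add_left:
  assumes "finite (supp p)" "finite (supp q)"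
  shows "pairing (p + q) f = pairing p f + pairing q f"
proof -
  let ?S = "supp p \<union> supp q"
  have "pairing (p + q) f = (\<Sum>v\<in>?S. (p + q) v * f v)"
    by (rule pairing_superset) (use assms supp_add[of p q] in auto)
  moreover have "pairing p f = (\<Sum>v\<in>?S. p v * f v)" "pairing q f = (\<Sum>v\<in>?S. q v * f v)"
    by (rule pairing_superset; use assms in auto)+
  ultimately show ?thesis
    by (simp add: sum.distrib algebra_simps)
qed

lemma pairing_scale_left:
  assumes "finite (supp p)"
  shows "pairing (\<lambda>v. k * p v) f = k * pairing p f"
  by (subst pairing_superset[OF assms supp_scale])
     (simp add: pairing_def sum_distrib_left mult.assoc)

lemma pairing_sum_left:
  assumes "finite I" "\<And>i. i \<in> I \<Longrightarrow> finite (supp (r i))"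
  shows "finite (supp (\<lambda>u. \<Sum>i\<in>I. k i * r i u))"
    and "pairing (\<lambda>u. \<Sum>i\<in>I. k i * r i u) f = (\<Sum>i\<in>I. k i * pairing (r i) f)"
proof -
  let ?S = "\<Union>i\<in>I. supp (r i)"
  have fin: "finite ?S" using assms by auto
  have sub: "supp (\<lambda>u. \<Sum>i\<in>I. k i * r i u) \<subseteq> ?S"
    by (force simp: supp_def intro: ccontr sum.neutral)
  show "finite (supp (\<lambda>u. \<Sum>i\<in>I. k i * r i u))"
    using finite_subset[OF sub fin] .
  have "pairing (\<lambda>u. \<Sum>i\<in>I. k i * r i u) f = (\<Sum>u\<in>?S. \<Sum>i\<in>I. k i * (r i u * f u))"
    by (subst pairing_superset[OF fin sub]) (simp add: sum_distrib_right mult.assoc)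
  also have "\<dots> = (\<Sum>i\<in>I. k i * (\<Sum>u\<in>?S. r i u * f u))"
    by (subst sum.swap) (simp add: sum_distrib_left)
  also have "\<dots> = (\<Sum>i\<in>I. k i * pairing (r i) f)"
    by (rule sum.cong[OF refl], subst pairing_superset[OF fin]) auto
  finally show "pairing (\<lambda>u. \<Sum>i\<in>I. k i * r i u) f = (\<Sum>i\<in>I. k i * pairing (r i) f)" .
qed

text \<open>
  Toeplitz's theorem on row-finite systems. The set \<open>G\<close> of equations, each pair \<open>(p, b)\<close>
  standing for \<open>pairing p f = b\<close>, is taken to be closed under linear combinations; then
  consistency says that \<open>G\<close> is the graph of a linear functional on its domain. Extended to
  all functions by means of a basis, this functional gives the value of \<open>f\<close> at \<open>v\<close> as its
  value at the indicator of \<open>v\<close>.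
\<close>
lemma solvable_if_consistent:
  fixes G :: "(('v \<Rightarrow> 'a::field) \<times> 'a) set"
  assumes zero: "(0, 0) \<in> G"
    and add: "\<And>p q b d. (p, b) \<in> G \<Longrightarrow> (q, d) \<in> G \<Longrightarrow> (p + q, b + d) \<in> G"
    and scale: "\<And>k p b. (p, b) \<in> G \<Longrightarrow> (\<lambda>v. k * p v, k * b) \<in> G"
    and finite_supp: "\<And>p b. (p, b) \<in> G \<Longrightarrow> finite (supp p)"
    and consistent: "\<And>b. (0, b) \<in> G \<Longrightarrow> b = 0"
  shows "\<exists>f. \<forall>p b. (p, b) \<in> G \<longrightarrow> pairing p f = b"
proof -
  interpret vs: vector_space_pair "\<lambda>(k::'a) (p::'v \<Rightarrow> 'a). (\<lambda>v. k * p v)" "(*) :: 'a \<Rightarrow> 'a \<Rightarrow> 'a"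
    by unfold_locales (auto simp: fun_eq_iff algebra_simps)
  obtain B where B: "B \<subseteq> fst ` G" "vs.vs1.independent B" "fst ` G \<subseteq> vs.vs1.span B"
    using vs.vs1.maximal_independent_subset by metis
  have "\<forall>p\<in>B. \<exists>b. (p, b) \<in> G" using B(1) by force
  then obtain \<phi> where \<phi>: "\<And>p. p \<in> B \<Longrightarrow> (p, \<phi> p) \<in> G" by metis
  obtain L where L: "Vector_Spaces.linear (\<lambda>k p v. k * p v) (*) L"
    and L_B: "\<And>p. p \<in> B \<Longrightarrow> L p = \<phi> p"
    using vs.linear_independent_extend[OF B(2), of \<phi>] by auto
  interpret L: Vector_Spaces.linear "\<lambda>(k::'a) (p::'v \<Rightarrow> 'a). (\<lambda>v. k * p v)" "(*)" L
    by (rule L)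
  have span: "(p, L p) \<in> G" if "p \<in> vs.vs1.span B" for p
    using that
  proof (induction rule: vs.vs1.span_induct_alt)
    case base
    then show ?case using zero unfolding L.zero .
  next
    case (step k p q)
    have "(p, L p) \<in> G" using \<phi> L_B step(1) by simp
    then show ?case
      unfolding L.add L.scale by (intro add scale step(2))
  qed
  have solves: "L p = b" if "(p, b) \<in> G" for p b
  proof -
    have "p \<in> vs.vs1.span B" using that B(3) by force
    from add[OF that scale[OF span[OF this], of "- 1"]]
    have "(0, b - L p) \<in> G" by (simp add: plus_fun_def zero_fun_def)
    then show ?thesis using consistent by fastforce
  qed
  define f where "f v = L (\<lambda>u. if u = v then 1 else 0)" for v
  have "pairing p f = L p" if "finite (supp p)" for p
  proof -
    have "p = (\<Sum>v\<in>supp p. (\<lambda>u. p v * (if u = v then 1 else 0)))"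
    proof
      fix u
      have "(\<Sum>v\<in>supp p. (\<lambda>u. p v * (if u = v then 1 else 0))) u
          = (\<Sum>v\<in>supp p. p v * (if u = v then 1 else 0))"
        using that by (induction rule: finite_induct) auto
      also have "\<dots> = (\<Sum>v\<in>supp p. if u = v then p v else 0)"
        by (rule sum.cong) auto
      also have "\<dots> = p u"
        using that by (simp add: sum.delta') (simp add: supp_def)
      finally show "p u = (\<Sum>v\<in>supp p. (\<lambda>u. p v * (if u = v then 1 else 0))) u" ..
    qed
    then have "L p = L (\<Sum>v\<in>supp p. (\<lambda>u. p v * (if u = v then 1 else 0)))" by simp
    also have "\<dots> = pairing p f"
      unfolding L.sum L.scale f_def pairing_def by simp
    finally show ?thesis by simp
  qed
  then show ?thesis using finite_supp solves by (intro exI[of _ f]) auto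
qed

section \<open>Closed subspaces as annihilators\<close>

definition annihilator :: "'v set \<Rightarrow> ('v \<Rightarrow> 'a::field) set \<Rightarrow> ('v \<Rightarrow> 'a) set" where
  "annihilator V W = {p. finite (supp p) \<and> supp p \<subseteq> V \<and> (\<forall>w\<in>W. pairing p w = 0)}"

text \<open>
  If no member of \<open>W\<close> agreed with \<open>f\<close> on \<open>S\<close>, then, cutting everything down to \<open>S\<close>, the
  requirements \<open>pairing w q = 0\<close> for \<open>w\<close> in \<open>W\<close> and \<open>pairing f q = 1\<close> would form
  a consistent system in an unknown \<open>q\<close>. Here the members of \<open>W\<close> supply the equations, as
  the two sides of the pairing are interchangeable on a finite set. A solution restricted to
  \<open>S\<close> annihilates \<open>W\<close> but not \<open>f\<close>.
\<close>
lemma agree_on_finite_set: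
  assumes W: "function_subspace V W" and S: "finite S" "S \<subseteq> V"
    and ann: "\<And>p. p \<in> annihilator V W \<Longrightarrow> pairing p f = 0"
  shows "\<exists>w\<in>W. \<forall>v\<in>S. w v = f v"
proof (rule ccontr)
  assume neg: "\<not> ?thesis"
  let ?e = "\<lambda>w k v. if v \<in> S then w v + k * f v else 0"
  define G where "G = {(?e w k, k) | w k. w \<in> W}"
  have G: "(?e w k, k) \<in> G" if "w \<in> W" for w k
    using that by (auto simp: G_def)
  have z: "(\<lambda>v\<in>V. 0) \<in> W" and a: "\<And>f g. f \<in> W \<Longrightarrow> g \<in> W \<Longrightarrow> (\<lambda>v\<in>V. f v + g v) \<in> W"
    and s: "\<And>k f. f \<in> W \<Longrightarrow> (\<lambda>v\<in>V. k * f v) \<in> W"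
    using W by (auto simp: function_subspace_def)
  have SV: "v \<in> V" if "v \<in> S" for v using that S by auto
  have "\<exists>q. \<forall>p b. (p, b) \<in> G \<longrightarrow> pairing p q = b"
  proof (rule solvable_if_consistent)
    have "?e (\<lambda>v\<in>V. 0) 0 = 0" by (auto simp: SV)
    then show "(0, 0) \<in> G" using G[OF z, of 0] by simp
  next
    fix p q b d assume "(p, b) \<in> G" "(q, d) \<in> G"
    then obtain w x where w: "w \<in> W" "p = ?e w b" and x: "x \<in> W" "q = ?e x d"
      by (auto simp: G_def)
    have "?e (\<lambda>v\<in>V. w v + x v) (b + d) = p + q"
      by (auto simp: SV w x algebra_simps)
    then show "(p + q, b + d) \<in> G" using G[OF a[OF w(1) x(1)], of "b + d"] by simp
  next
    fix k p b assume "(p, b) \<in> G"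
    then obtain w where w: "w \<in> W" "p = ?e w b"
      by (auto simp: G_def)
    have "?e (\<lambda>v\<in>V. k * w v) (k * b) = (\<lambda>v. k * p v)"
      by (auto simp: SV w algebra_simps)
    then show "(\<lambda>v. k * p v, k * b) \<in> G" using G[OF s[OF w(1), of k], of "k * b"] by simp
  next
    fix p b assume "(p, b) \<in> G"
    then have "supp p \<subseteq> S" by (auto simp: G_def supp_def split: if_splits)
    then show "finite (supp p)" using S(1) finite_subset by blast
  next
    fix b assume "(0, b) \<in> G"
    then obtain w where w: "w \<in> W" "0 = ?e w b" by (auto simp: G_def)
    show "b = 0"
    proof (rule ccontr)
      assume "b \<noteq> 0"
      \<comment> \<open>From \<open>w + b f = 0\<close> on \<open>S\<close> a rescaling of \<open>w\<close> would agree with \<open>f\<close> there.\<close>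
      have "(\<lambda>v\<in>V. (- 1 / b) * w v) v = f v" if "v \<in> S" for v
      proof -
        have "w v + b * f v = 0" using fun_cong[OF w(2), of v] that by simp
        then have "w v = - (b * f v)" by (simp add: eq_neg_iff_add_eq_0)
        then show ?thesis using \<open>b \<noteq> 0\<close> SV[OF that] by simp
      qed
      then show False using neg s[OF w(1), of "- 1 / b"] by blast
    qed
  qed
  then obtain q where q: "\<And>p b. (p, b) \<in> G \<Longrightarrow> pairing p q = b" by blast
  define p where "p v = (if v \<in> S then q v else 0)" for v
  have supp_p: "supp p \<subseteq> S" by (auto simp: p_def supp_def)
  have pair: "pairing p w + k * pairing p f = k" if "w \<in> W" for w k
  proof -
    have "supp (?e w k) \<subseteq> S" by (auto simp: supp_def)
    then have "(\<Sum>v\<in>S. ?e w k v * q v) = k"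
      using q[OF G[OF that, of k]] pairing_superset[OF S(1)] by metis
    moreover have "(\<Sum>v\<in>S. ?e w k v * q v) = pairing p w + k * pairing p f"
      by (simp add: pairing_superset[OF S(1) supp_p] p_def sum_distrib_left
          sum.distrib[symmetric] algebra_simps)
    ultimately show ?thesis by simp
  qed
  have "p \<in> annihilator V W"
    using pair[of _ 0] supp_p S finite_subset by (auto simp: annihilator_def)
  then show False using ann pair[OF z, of 1] by (auto simp: annihilator_def z)
qed

context absolute_value
begin

lemma av_sum: "av (\<Sum>i\<in>I. x i) \<le> (\<Sum>i\<in>I. av (x i))"
proof (induction I rule: infinite_finite_induct)
  case (insert i I)
  then show ?case using triangle_ineq[of "x i" "\<Sum>i\<in>I. x i"] by simp
qed (use eq_zero_iff[of 0] in auto)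

text \<open>
  Continuity of the functional given by \<open>p\<close>, made quantitative: if \<open>w\<close> is within \<open>e\<close> of \<open>f\<close>
  on the support of \<open>p\<close>, then the two values differ by at most \<open>e\<close> times the sum of the
  absolute values of the entries of \<open>p\<close>.
\<close>
lemma annihilated_in_closure:
  assumes f: "f \<in> function_topology V av closure_of W" and p: "p \<in> annihilator V W"
  shows "pairing p f = 0"
proof (rule ccontr)
  assume neq: "pairing p f \<noteq> 0"
  \<comment> \<open>The summand 1 makes \<open>?M\<close> positive and the final inequality strict.\<close>
  let ?d = "pairing p f" and ?M = "1 + (\<Sum>v\<in>supp p. av (p v))"
  have fin: "finite (supp p)" "supp p \<subseteq> V" using p by (auto simp: annihilator_def)
  have M: "?M > 0" using sum_nonneg[of "supp p" "\<lambda>v. av (p v)"] nonneg by fastforce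
  have d: "av ?d > 0" using neq nonneg[of ?d] eq_zero_iff[of ?d] by linarith
  define e where "e = av ?d / ?M"
  have e: "e > 0" using M d by (simp add: e_def)
  define U where "U = Pi\<^sub>E V (\<lambda>v. if v \<in> supp p then mball (f v) e else UNIV)"
  have "openin (function_topology V av) U"
    unfolding U_def function_topology_def field_topology_def
    by (subst openin_PiE_gen) (auto intro: finite_subset[OF _ fin(1)] split: if_splits
        simp: openin_topspace[of mtopology, simplified])
  moreover have "f \<in> U"
    using f e eq_zero_iff[of 0] topspace_function_topology[OF absolute_value_axioms, of V]
    by (auto simp: U_def in_closure_of PiE_iff)
  ultimately obtain w where w: "w \<in> W" "w \<in> U"
    using f by (auto simp: in_closure_of)
  have close: "av (f v - w v) \<le> e" if "v \<in> supp p" for v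
    using w(2) that fin(2) by (fastforce simp: U_def PiE_iff)
  have "?d = (\<Sum>v\<in>supp p. p v * (f v - w v))"
    using p w(1) by (simp add: annihilator_def pairing_def right_diff_distrib sum_subtractf)
  then have "av ?d \<le> (\<Sum>v\<in>supp p. av (p v) * av (f v - w v))"
    using av_sum[of "\<lambda>v. p v * (f v - w v)" "supp p"] by (simp add: mult)
  also have "\<dots> \<le> (\<Sum>v\<in>supp p. av (p v) * e)"
    by (intro sum_mono mult_left_mono close nonneg)
  also have "\<dots> = (?M - 1) * e" by (simp add: sum_distrib_right)
  also have "\<dots> < ?M * e" using e by simp
  also have "\<dots> = av ?d" using M by (simp add: e_def)
  finally show False by simp
qed

lemma closure_of_subspace_iff:
  assumes W: "function_subspace V W"
  shows "f \<in> function_topology V av closure_of W \<longleftrightarrow>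
    f \<in> V \<rightarrow>\<^sub>E UNIV \<and> (\<forall>p\<in>annihilator V W. pairing p f = 0)"
proof (intro iffI conjI)
  note top = topspace_function_topology[OF absolute_value_axioms, of V]
  assume f: "f \<in> function_topology V av closure_of W"
  then show "f \<in> V \<rightarrow>\<^sub>E UNIV" using top by (auto simp: in_closure_of)
  show "\<forall>p\<in>annihilator V W. pairing p f = 0" using annihilated_in_closure[OF f] by blast
next
  note top = topspace_function_topology[OF absolute_value_axioms, of V]
  assume f: "f \<in> V \<rightarrow>\<^sub>E UNIV \<and> (\<forall>p\<in>annihilator V W. pairing p f = 0)"
  have *: "\<forall>f\<in>T. \<exists>U. finite {v\<in>V. U v \<noteq> UNIV} \<and> f \<in> Pi\<^sub>E V U \<and> Pi\<^sub>E V U \<subseteq> T"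
    if "openin (function_topology V av) T" for T
    using that unfolding function_topology_def field_topology_def openin_product_topology_alt
    by (simp only: topspace_mtopology) meson
  have "\<exists>w. w \<in> W \<and> w \<in> T" if T: "f \<in> T" "openin (function_topology V av) T" for T
  proof -
    obtain U where U: "finite {v\<in>V. U v \<noteq> UNIV}" "f \<in> Pi\<^sub>E V U" "Pi\<^sub>E V U \<subseteq> T"
      using T *[OF T(2)] by blast
    obtain w where w: "w \<in> W" "\<forall>v\<in>{v\<in>V. U v \<noteq> UNIV}. w v = f v"
      using agree_on_finite_set[OF W U(1)] f by blast
    have "w \<in> V \<rightarrow>\<^sub>E UNIV" using w(1) W by (auto simp: function_subspace_def)
    then have "w \<in> Pi\<^sub>E V U"
      using U(2) w(2) by (auto simp: PiE_iff)
    then show ?thesis using w(1) U(3) by blast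
  qed
  then show "f \<in> function_topology V av closure_of W"
    using f top by (auto simp: in_closure_of)
qed

end

section \<open>Row-finite operators\<close>

definition row_operator :: "'v set \<Rightarrow> ('v \<Rightarrow> 'v \<Rightarrow> 'a::field) \<Rightarrow> ('v \<Rightarrow> 'a) \<Rightarrow> 'v \<Rightarrow> 'a" where
  "row_operator V r f = (\<lambda>v\<in>V. pairing (r v) f)"

locale row_finite =
  fixes V :: "'v set" and r :: "'v \<Rightarrow> 'v \<Rightarrow> 'a::field"
  assumes finite_row: "v \<in> V \<Longrightarrow> finite (supp (r v))"
    and row_subset: "v \<in> V \<Longrightarrow> supp (r v) \<subseteq> V"
begin

definition transpose :: "('v \<Rightarrow> 'a) \<Rightarrow> 'v \<Rightarrow> 'a" where
  "transpose p = (\<lambda>u. \<Sum>v\<in>supp p. p v * r v u)"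

lemma transpose_superset:
  assumes "finite S" "supp p \<subseteq> S"
  shows "transpose p = (\<lambda>u. \<Sum>v\<in>S. p v * r v u)"
  unfolding transpose_def
  by (rule ext, rule sum.mono_neutral_left) (use assms in \<open>auto simp: supp_def\<close>)

lemma transpose_add:
  assumes "finite (supp p)" "finite (supp q)"
  shows "transpose (p + q) = transpose p + transpose q"
proof -
  let ?S = "supp p \<union> supp q"
  have "transpose (p + q) = (\<lambda>u. \<Sum>v\<in>?S. (p + q) v * r v u)"
    by (rule transpose_superset) (use assms supp_add[of p q] in auto)
  moreover have "transpose p = (\<lambda>u. \<Sum>v\<in>?S. p v * r v u)"
     "transpose q = (\<lambda>u. \<Sum>v\<in>?S. q v * r v u)"
    by (rule transpose_superset; use assms in auto)+
  ultimately show ?thesis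
    by (simp add: fun_eq_iff sum.distrib algebra_simps)
qed

lemma transpose_scale:
  assumes "finite (supp p)"
  shows "transpose (\<lambda>v. k * p v) = (\<lambda>v. k * transpose p v)"
  by (subst transpose_superset[OF assms supp_scale])
     (simp add: transpose_def sum_distrib_left mult.assoc)

lemma
  assumes "finite (supp p)" "supp p \<subseteq> V"
  shows finite_supp_transpose: "finite (supp (transpose p))"
    and supp_transpose: "supp (transpose p) \<subseteq> V"
    and pairing_transpose: "pairing (transpose p) f = pairing p (row_operator V r f)"
proof -
  show "finite (supp (transpose p))"
    unfolding transpose_def by (rule pairing_sum_left) (use assms finite_row in auto)
  show "supp (transpose p) \<subseteq> V"
  proof
    fix u assume "u \<in> supp (transpose p)"
    then have "(\<Sum>v\<in>supp p. p v * r v u) \<noteq> 0" by (simp add: supp_def transpose_def)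
    then obtain v where "v \<in> supp p" "p v * r v u \<noteq> 0" by (meson sum.neutral)
    then show "u \<in> V" using row_subset[of v] assms(2) by (auto simp: supp_def)
  qed
  have "pairing (transpose p) f = (\<Sum>v\<in>supp p. p v * pairing (r v) f)"
    unfolding transpose_def by (rule pairing_sum_left) (use assms finite_row in auto)
  also have "\<dots> = pairing p (row_operator V r f)"
    unfolding pairing_def[of p] using assms(2) by (auto intro!: sum.cong simp: row_operator_def)
  finally show "pairing (transpose p) f = pairing p (row_operator V r f)" .
qed

lemma annihilator_image:
  "p \<in> annihilator V (row_operator V r ` W) \<longleftrightarrow>
    finite (supp p) \<and> supp p \<subseteq> V \<and> transpose p \<in> annihilator V W"
  using finite_supp_transpose supp_transpose pairing_transpose
  by (auto simp: annihilator_def)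

text \<open>
  The equations in the unknown \<open>f\<close> are those of membership in the closure of \<open>W\<close>, with left
  side in the annihilator of \<open>W\<close> and right side 0, and those of \<open>row_operator V r f = g\<close>
  tested against every finitely supported \<open>p\<close>. Testing against all \<open>p\<close>, and not only
  against indicators of points, makes the system closed under linear combinations.
\<close>
lemma preimage_of_annihilated:
  assumes g: "g \<in> V \<rightarrow>\<^sub>E UNIV"
    and ann: "\<And>p. p \<in> annihilator V (row_operator V r ` W) \<Longrightarrow> pairing p g = 0"
  shows "\<exists>f\<in>V \<rightarrow>\<^sub>E UNIV. (\<forall>n\<in>annihilator V W. pairing n f = 0) \<and> row_operator V r f = g"
proof -
  define P where "P = {p :: 'v \<Rightarrow> 'a. finite (supp p) \<and> supp p \<subseteq> V}"
  have P_add: "p + q \<in> P" if "p \<in> P" "q \<in> P" for p q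
    using that supp_add[of p q] finite_subset[OF supp_add[of p q]] by (auto simp: P_def)
  have P_scale: "(\<lambda>v. k * p v) \<in> P" if "p \<in> P" for k p
    using that supp_scale[of k p] finite_subset[OF supp_scale[of k p]] by (auto simp: P_def)
  have P_0: "0 \<in> P" by (simp add: P_def supp_def)
  let ?N = "annihilator V W"
  have N: "n \<in> P" "w \<in> W \<Longrightarrow> pairing n w = 0" if "n \<in> ?N" for n w
    using that by (auto simp: annihilator_def P_def)
  have N_I: "n \<in> ?N" if "n \<in> P" "\<And>w. w \<in> W \<Longrightarrow> pairing n w = 0" for n
    using that by (auto simp: annihilator_def P_def)
  have N_add: "n + m \<in> ?N" if "n \<in> ?N" "m \<in> ?N" for n m
    using N[OF that(1)] N[OF that(2)] P_add
    by (intro N_I) (auto simp: P_def pairing_add_left)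
  have N_scale: "(\<lambda>v. k * n v) \<in> ?N" if "n \<in> ?N" for k n
    using N[OF that] P_scale
    by (intro N_I) (auto simp: P_def pairing_scale_left)
  have N_0: "0 \<in> ?N" using P_0 by (intro N_I) (auto simp: pairing_def supp_def)
  define G where "G = {(n + transpose p, pairing p g) | n p. n \<in> ?N \<and> p \<in> P}"
  have G: "(n + transpose p, pairing p g) \<in> G" if "n \<in> ?N" "p \<in> P" for n p
    using that by (auto simp: G_def)
  have t0: "transpose 0 = 0" "pairing 0 g = 0"
    by (auto simp: transpose_def pairing_def supp_def)
  have "\<exists>f. \<forall>p b. (p, b) \<in> G \<longrightarrow> pairing p f = b"
  proof (rule solvable_if_consistent)
    show "(0, 0) \<in> G" using G[OF N_0 P_0] t0 by simp
  next
    fix x y b d assume "(x, b) \<in> G" "(y, d) \<in> G"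
    then obtain n p m q where x: "n \<in> ?N" "p \<in> P" "x = n + transpose p" "b = pairing p g"
      and y: "m \<in> ?N" "q \<in> P" "y = m + transpose q" "d = pairing q g"
      by (auto simp: G_def)
    have "x + y = (n + m) + transpose (p + q)" "b + d = pairing (p + q) g"
      using x(2) y(2) unfolding x(3,4) y(3,4)
      by (simp_all add: P_def transpose_add pairing_add_left algebra_simps)
    then show "(x + y, b + d) \<in> G" using G[OF N_add P_add] x y by metis
  next
    fix k x b assume "(x, b) \<in> G"
    then obtain n p where x: "n \<in> ?N" "p \<in> P" "x = n + transpose p" "b = pairing p g"
      by (auto simp: G_def)
    have "(\<lambda>v. k * x v) = (\<lambda>v. k * n v) + transpose (\<lambda>v. k * p v)"
      "k * b = pairing (\<lambda>v. k * p v) g"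
      using x(2) unfolding x(3,4)
      by (simp_all add: P_def transpose_scale pairing_scale_left fun_eq_iff algebra_simps)
    then show "(\<lambda>v. k * x v, k * b) \<in> G" using G[OF N_scale P_scale] x by metis
  next
    fix x b assume "(x, b) \<in> G"
    then obtain n p where x: "n \<in> ?N" "p \<in> P" "x = n + transpose p" by (auto simp: G_def)
    then show "finite (supp x)"
      using N(1)[OF x(1)] finite_supp_transpose[of p] finite_subset[OF supp_add[of n "transpose p"]]
      by (auto simp: P_def)
  next
    fix b assume "(0, b) \<in> G"
    then obtain n p where x: "n \<in> ?N" "p \<in> P" "0 = n + transpose p" "b = pairing p g"
      by (auto simp: G_def)
    have "transpose p = (\<lambda>v. (- 1) * n v)"
      using x(3) by (simp add: fun_eq_iff) (metis add_eq_0_iff)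
    then have "transpose p \<in> ?N" using N_scale[OF x(1), of "- 1"] by simp
    then show "b = 0" using ann[of p] x(2,4) by (auto simp: annihilator_image P_def)
  qed
  then obtain h where h: "\<And>p b. (p, b) \<in> G \<Longrightarrow> pairing p h = b" by blast
  show ?thesis
  proof (intro bexI[of _ "restrict h V"] conjI ballI)
    have res: "pairing p (restrict h V) = pairing p h" if "supp p \<subseteq> V" for p
      using that by (intro pairing_cong) auto
    show "restrict h V \<in> V \<rightarrow>\<^sub>E UNIV" by simp
    show "pairing n (restrict h V) = 0" if "n \<in> ?N" for n
      using h[OF G[OF that P_0]] N(1)[OF that] by (simp add: t0 res P_def)
    show "row_operator V r (restrict h V) = g"
    proof (rule PiE_ext[OF _ g])
      show "row_operator V r (restrict h V) \<in> V \<rightarrow>\<^sub>E UNIV" by (simp add: row_operator_def)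
      fix v assume v: "v \<in> V"
      define p where "p = (\<lambda>u. if u = v then 1 else 0 :: 'a)"
      have p: "supp p = {v}" by (auto simp: p_def supp_def)
      have "p \<in> P" using p v by (simp add: P_def)
      from h[OF G[OF N_0 this]] have "pairing (r v) h = g v"
        by (simp add: transpose_def pairing_def[of p] p) (simp add: p_def)
      then show "row_operator V r (restrict h V) v = g v"
        using v row_subset by (simp add: row_operator_def res)
    qed
  qed
qed

lemma function_subspace_image:
  assumes "function_subspace V W"
  shows "function_subspace V (row_operator V r ` W)"
proof -
  let ?T = "row_operator V r"
  have lin: "?T (\<lambda>v\<in>V. 0) = (\<lambda>v\<in>V. 0)"
    "?T (\<lambda>v\<in>V. f v + g v) = (\<lambda>v\<in>V. ?T f v + ?T g v)"
    "?T (\<lambda>v\<in>V. k * f v) = (\<lambda>v\<in>V. k * ?T f v)" for f g k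
  proof -
    have V: "u \<in> V" if "v \<in> V" "u \<in> supp (r v)" for u v using that row_subset by blast
    show "?T (\<lambda>v\<in>V. 0) = (\<lambda>v\<in>V. 0)"
      by (auto simp: row_operator_def pairing_def V intro!: restrict_ext)
    show "?T (\<lambda>v\<in>V. f v + g v) = (\<lambda>v\<in>V. ?T f v + ?T g v)"
      by (auto simp: row_operator_def pairing_def V distrib_left sum.distrib intro!: restrict_ext)
    show "?T (\<lambda>v\<in>V. k * f v) = (\<lambda>v\<in>V. k * ?T f v)"
      by (auto simp: row_operator_def pairing_def V sum_distrib_left mult.left_commute
          intro!: restrict_ext)
  qed
  have W: "(\<lambda>v\<in>V. 0) \<in> W" "\<And>f g. f \<in> W \<Longrightarrow> g \<in> W \<Longrightarrow> (\<lambda>v\<in>V. f v + g v) \<in> W"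
    "\<And>k f. f \<in> W \<Longrightarrow> (\<lambda>v\<in>V. k * f v) \<in> W"
    using assms by (auto simp: function_subspace_def)
  show ?thesis
    unfolding function_subspace_def
  proof (intro conjI ballI allI)
    show "?T ` W \<subseteq> V \<rightarrow>\<^sub>E UNIV" by (auto simp: row_operator_def)
    show "(\<lambda>v\<in>V. 0) \<in> ?T ` W" using W(1) by (metis lin(1) imageI)
    fix f assume "f \<in> ?T ` W"
    then obtain f' where f: "f' \<in> W" "f = ?T f'" by blast
    show "(\<lambda>v\<in>V. f v + g v) \<in> ?T ` W" if "g \<in> ?T ` W" for g
      using that f W(2) by (auto simp flip: lin(2))
    show "(\<lambda>v\<in>V. k * f v) \<in> ?T ` W" for k
      using W(3)[OF f(1)] unfolding f(2) lin(3)[symmetric] by (rule imageI)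
  qed
qed

lemma closure_of_image:
  assumes av: "absolute_value av" and W: "function_subspace V W"
  shows "function_topology V av closure_of (row_operator V r ` W)
    = row_operator V r ` (function_topology V av closure_of W)"
proof (intro subset_antisym subsetI)
  note iff = absolute_value.closure_of_subspace_iff[OF av]
  fix g assume "g \<in> function_topology V av closure_of (row_operator V r ` W)"
  then have "g \<in> V \<rightarrow>\<^sub>E UNIV" "\<And>p. p \<in> annihilator V (row_operator V r ` W) \<Longrightarrow> pairing p g = 0"
    by (auto simp: iff[OF function_subspace_image[OF W]])
  then obtain f where "f \<in> V \<rightarrow>\<^sub>E UNIV" "\<forall>n\<in>annihilator V W. pairing n f = 0"
    "row_operator V r f = g"
    using preimage_of_annihilated by meson
  then show "g \<in> row_operator V r ` (function_topology V av closure_of W)"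
    by (auto simp: iff[OF W])
next
  note iff = absolute_value.closure_of_subspace_iff[OF av]
  fix g assume "g \<in> row_operator V r ` (function_topology V av closure_of W)"
  then obtain f where f: "\<forall>n\<in>annihilator V W. pairing n f = 0"
    "g = row_operator V r f"
    by (auto simp: iff[OF W])
  have "g \<in> V \<rightarrow>\<^sub>E UNIV" by (simp add: f(2) row_operator_def)
  moreover have "pairing p g = 0" if "p \<in> annihilator V (row_operator V r ` W)" for p
    using that f pairing_transpose[of p f] by (auto simp: annihilator_image)
  ultimately show "g \<in> function_topology V av closure_of (row_operator V r ` W)"
    by (auto simp: iff[OF function_subspace_image[OF W]])
qed

end

section \<open>The adjacency operator\<close>

definition shifted_adjacency_row :: "'v set \<Rightarrow> 'v set set \<Rightarrow> 'a \<Rightarrow> 'v \<Rightarrow> 'v \<Rightarrow> 'a::field" where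
  "shifted_adjacency_row V E c v u =
    (if u \<in> neighbours V E v then 1 else 0) - (if u = v then c else 0)"

context locally_finite_graph
begin

lemma supp_shifted_adjacency_row:
  "supp (shifted_adjacency_row V E c v) \<subseteq> insert v (neighbours V E v)"
  by (auto simp: supp_def shifted_adjacency_row_def)

lemma row_finite_shifted_adjacency_row: "row_finite V (shifted_adjacency_row V E c)"
proof
  fix v assume v: "v \<in> V"
  show "finite (supp (shifted_adjacency_row V E c v))"
    using finite_subset[OF supp_shifted_adjacency_row] finite_neighbours[OF v] by simp
  show "supp (shifted_adjacency_row V E c v) \<subseteq> V"
    using supp_shifted_adjacency_row[of c v] v by (auto simp: neighbours_def)
qed

lemma shifted_adjacency_operator_eq:
  "shifted_adjacency_operator V E c = row_operator V (shifted_adjacency_row V E c)"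
proof (intro ext)
  fix f v
  show "shifted_adjacency_operator V E c f v = row_operator V (shifted_adjacency_row V E c) f v"
  proof (cases "v \<in> V")
    case True
    let ?S = "insert v (neighbours V E v)"
    have fin: "finite ?S" using finite_neighbours[OF True] by simp
    have "pairing (shifted_adjacency_row V E c v) f
        = (\<Sum>u\<in>?S. if u \<in> neighbours V E v then f u else 0) - (\<Sum>u\<in>?S. if u = v then c * f u else 0)"
      unfolding pairing_superset[OF fin supp_shifted_adjacency_row] sum_subtractf[symmetric]
      by (rule sum.cong) (auto simp: shifted_adjacency_row_def algebra_simps)
    also have "(\<Sum>u\<in>?S. if u \<in> neighbours V E v then f u else 0) = (\<Sum>u\<in>neighbours V E v. f u)"
      by (rule sum.mono_neutral_cong_right[OF fin]) auto
    also have "(\<Sum>u\<in>?S. if u = v then c * f u else 0) = c * f v"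
      using fin by (subst sum.delta) auto
    finally show ?thesis
      using True by (simp add: shifted_adjacency_operator_def adjacency_operator_def row_operator_def)
  qed (simp add: shifted_adjacency_operator_def row_operator_def)
qed

end

theorem mainTheorem9:
  fixes V :: "'v set" and E :: "'v set set"
    and av :: "'a::field \<Rightarrow> real" and c :: 'a
  assumes "locally_finite_graph V E"
    and "absolute_value av"
  shows "(\<forall>W. function_subspace V W \<longrightarrow>
            function_topology V av closure_of (shifted_adjacency_operator V E c ` W)
              = shifted_adjacency_operator V E c ` (function_topology V av closure_of W))
       \<and> (\<forall>W. function_subspace V W \<and> closedin (function_topology V av) W \<longrightarrow>
            function_subspace V (shifted_adjacency_operator V E c ` W)
            \<and> closedin (function_topology V av) (shifted_adjacency_operator V E c ` W))"
proof -
  interpret locally_finite_graph V E by fact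
  interpret row_finite V "shifted_adjacency_row V E c"
    by (rule row_finite_shifted_adjacency_row)
  note closure = closure_of_image[OF assms(2)]
  show ?thesis
    unfolding shifted_adjacency_operator_eq
    using closure function_subspace_image by (metis closure_of_eq)
qed

end
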